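(* Let $\theta:\{0,1,2\}\to\{0,1,2\}$ be given by $\theta(0)=0$, $\theta(1)=2$, $\theta(2)=1$. Any number $x\in[0,1]$ can be represented in the form $$x=\Delta^{3'}_{\beta_1\beta_2\ldots\beta_n\ldots}=\sum_{n=1}^{\infty}\frac{\theta(\alpha_n)}{3^n},\qquad \alpha_n\in\{0,1,2\},\ \beta_n=\theta(\alpha_n).$$ Every $3'$-irrational number has a unique $3'$-representation. Every $3'$-rational number has two different $3'$-representations.
   Context: For a sequence $(\alpha_n)$ with $\alpha_n\in\{0,1,2\}$, put $\beta_n=\theta(\alpha_n)$; the $3'$-representation (pseudo-ternary representation) is $\Delta^{3'}_{\beta_1\beta_2\ldots}=\sum_{n\ge1}\theta(\alpha_n)3^{-n}=\sum_{n\ge1}\beta_n3^{-n}$. Parentheses denote a period. A number in $[0,1]$ is called $3'$-rational if it is of the form $$\Delta^{3'}_{c_1c_2\ldots c_{n-1}c_n(0)}=\Delta^{3'}_{c_1c_2\ldots c_{n-1}[c_n-1](2)},\quad c_j\in\{0,1,2\},\ c_n\neq0,$$ and all other numbers in $[0,1]$ are called $3'$-irrational. *)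

theory Defs
  imports Complex_Main
begin

text \<open>
  Infinite digit sequences are functions on \<open>nat\<close> indexed from 0: the value at \<open>n\<close> is the
  digit in position \<open>n + 1\<close>, hence the weight \<open>1 / 3 ^ Suc n\<close>.
\<close>

definition digits :: "nat set" where
  "digits = {0, 1, 2}"

text \<open>Only the values of \<open>\<theta>\<close> on \<open>digits\<close> matter; elsewhere it is the identity.\<close>

definition \<theta> :: "nat \<Rightarrow> nat" where
  "\<theta> d = (if d = 0 then 0 else if d = 1 then 2 else if d = 2 then 1 else d)"

definition Delta3' :: "(nat \<Rightarrow> nat) \<Rightarrow> real" where
  "Delta3' \<beta> = (\<Sum>n. real (\<beta> n) / 3 ^ Suc n)"

definition is_3'_representation :: "(nat \<Rightarrow> nat) \<Rightarrow> real \<Rightarrow> bool" where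
  "is_3'_representation \<beta> x \<longleftrightarrow>
     (\<exists>\<alpha>. (\<forall>n. \<alpha> n \<in> digits) \<and> (\<forall>n. \<beta> n = \<theta> (\<alpha> n))) \<and> x = Delta3' \<beta>"

text \<open>
  The finite word \<open>c 0, \<dots>, c m\<close> (of length \<open>m + 1 \<ge> 1\<close>) followed by the period \<open>(0)\<close>, and
  the same word with its last digit lowered by one followed by the period \<open>(2)\<close>.
\<close>

definition ending_0 :: "nat \<Rightarrow> (nat \<Rightarrow> nat) \<Rightarrow> nat \<Rightarrow> nat" where
  "ending_0 m c = (\<lambda>i. if i \<le> m then c i else 0)"

definition ending_2 :: "nat \<Rightarrow> (nat \<Rightarrow> nat) \<Rightarrow> nat \<Rightarrow> nat" where
  "ending_2 m c = (\<lambda>i. if i < m then c i else if i = m then c m - 1 else 2)"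

text \<open>
  The definition mentions only the first of the two forms; \<open>Delta3'_ending_0_eq_ending_2\<close>
  below shows that the second form has the same value.
\<close>

definition is_3'_rational :: "real \<Rightarrow> bool" where
  "is_3'_rational x \<longleftrightarrow> x \<in> {0..1} \<and>
     (\<exists>m c. (\<forall>j\<le>m. c j \<in> digits) \<and> c m \<noteq> 0 \<and> x = Delta3' (ending_0 m c))"

definition is_3'_irrational :: "real \<Rightarrow> bool" where
  "is_3'_irrational x \<longleftrightarrow> x \<in> {0..1} \<and> \<not> is_3'_rational x"

lemma summable_digits:
  assumes "\<And>n. \<beta> n \<in> digits"
  shows "summable (\<lambda>n. real (\<beta> n) / 3 ^ Suc n)"
proof (rule summable_comparison_test')
  show "summable (\<lambda>n. 2 * (1 / 3 :: real) ^ Suc n)"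
    by (intro summable_mult summable_Suc_iff[THEN iffD2] summable_geometric) auto
  show "norm (real (\<beta> n) / 3 ^ Suc n) \<le> 2 * (1 / 3) ^ Suc n" for n
  proof -
    have "real (\<beta> n) \<le> 2" using assms[of n] by (auto simp: digits_def)
    then have "real (\<beta> n) / 3 ^ Suc n \<le> 2 / 3 ^ Suc n" by (intro divide_right_mono) auto
    then show ?thesis by (simp add: power_one_over)
  qed
qed

lemma Delta3'_ending_0_eq_ending_2:
  assumes c: "\<And>j. j \<le> m \<Longrightarrow> c j \<in> digits" and cm: "c m \<noteq> 0"
  shows "Delta3' (ending_0 m c) = Delta3' (ending_2 m c)"
proof -
  let ?f = "\<lambda>\<beta> n. real (\<beta> n) / 3 ^ Suc n"
  have s0: "summable (?f (ending_0 m c))"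
    by (rule summable_digits) (use c in \<open>auto simp: ending_0_def digits_def\<close>)
  have "ending_2 m c n \<in> digits" for n
    using c[of n] c[of m] by (auto simp: ending_2_def digits_def)
  then have s2: "summable (?f (ending_2 m c))" by (rule summable_digits)
  have t0: "(\<Sum>n. ?f (ending_0 m c) (n + Suc m)) = 0"
    by (simp add: ending_0_def)
  have geo: "(\<lambda>n. (2 / 3 ^ (m + 2)) * (1 / 3 :: real) ^ n) sums
        ((2 / 3 ^ (m + 2)) * (1 / (1 - 1 / 3)))"
    by (intro sums_mult geometric_sums) auto
  have tail: "?f (ending_2 m c) (n + Suc m) = (2 / 3 ^ (m + 2)) * (1 / 3) ^ n" for n
    by (simp add: ending_2_def power_add power_one_over)
  have val: "(2 / 3 ^ (m + 2)) * (1 / (1 - 1 / 3)) = (1 / 3 ^ Suc m :: real)"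
    by simp
  have "(\<lambda>n. ?f (ending_2 m c) (n + Suc m)) sums (1 / 3 ^ Suc m)"
    using geo unfolding tail val .
  then have t2: "(\<Sum>n. ?f (ending_2 m c) (n + Suc m)) = 1 / 3 ^ Suc m"
    by (rule sums_unique[symmetric])
  have "(\<Sum>n<Suc m. ?f (ending_0 m c) n) = (\<Sum>n<m. ?f c n) + real (c m) / 3 ^ Suc m"
    by (simp add: ending_0_def)
  moreover have "(\<Sum>n<Suc m. ?f (ending_2 m c) n)
      = (\<Sum>n<m. ?f c n) + (real (c m) - 1) / 3 ^ Suc m"
    using cm by (simp add: ending_2_def of_nat_diff)
  ultimately have "(\<Sum>n<Suc m. ?f (ending_0 m c) n)
      = (\<Sum>n<Suc m. ?f (ending_2 m c) n) + 1 / 3 ^ Suc m"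
    by (simp add: diff_divide_distrib)
  then show ?thesis
    unfolding Delta3'_def
    using suminf_split_initial_segment[OF s0, of "Suc m"]
      suminf_split_initial_segment[OF s2, of "Suc m"] t0 t2
    by linarith
qed

end

theory Submission
  imports Defs
begin

text \<open>
  Since \<open>\<theta>\<close> permutes \<open>{0, 1, 2}\<close>, the \<open>3'\<close>-representations of a number are exactly
  its ordinary ternary expansions, and the theorem is the classical statement about those.

  Existence is the greedy algorithm: the remainder \<open>r\<close> in \<open>[0, 1]\<close> is tripled and the largest
  digit \<open>d\<close> with \<open>d \<le> 3 * r\<close> is split off; the \<open>n\<close>-th remainder has weight \<open>1 / 3 ^ n\<close>, so the
  partial sums converge to \<open>x\<close>.

  Uniqueness rests on one observation. Suppose that two expansions of the same number first
  differ in position \<open>m\<close>, with the digits \<open>b < c\<close> there. What remains satisfies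
  \<open>b + s = c + t\<close>, where \<open>s\<close> and \<open>t\<close> are the values of the two tails. Both lie in \<open>[0, 1]\<close>, so
  \<open>c = b + 1\<close>, \<open>s = 1\<close> and \<open>t = 0\<close>; and the values \<open>1\<close> and \<open>0\<close> are attained only by the
  constant sequences \<open>2, 2, \<dots>\<close> and \<open>0, 0, \<dots>\<close>. Thus the expansions are the two forms that
  define a \<open>3'\<close>-rational number (\<open>first_difference\<close>). So a number with two expansions is
  \<open>3'\<close>-rational; and an expansion different from a given \<open>c 0, \<dots>, c m, 0, 0, \<dots>\<close> with
  \<open>c m \<noteq> 0\<close> can only differ from it first in position \<open>m\<close>, which determines it.
\<close>

section \<open>Representations as ternary expansions\<close>

lemma digits_iff: "d \<in> digits \<longleftrightarrow> d \<le> 2"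
  by (auto simp: digits_def)

lemma \<theta>_in_digits_iff: "\<theta> d \<in> digits \<longleftrightarrow> d \<in> digits"
  by (auto simp: \<theta>_def digits_def)

lemma \<theta>_involution: "\<theta> (\<theta> d) = d"
  by (simp add: \<theta>_def)

lemma is_3'_representation_iff:
  "is_3'_representation \<beta> x \<longleftrightarrow> (\<forall>n. \<beta> n \<in> digits) \<and> x = Delta3' \<beta>"
proof -
  have "\<exists>\<alpha>. (\<forall>n. \<alpha> n \<in> digits) \<and> (\<forall>n. \<beta> n = \<theta> (\<alpha> n))" if "\<forall>n. \<beta> n \<in> digits"
    by (rule exI[of _ "\<lambda>n. \<theta> (\<beta> n)"]) (use that in \<open>simp add: \<theta>_in_digits_iff \<theta>_involution\<close>)
  moreover have "\<forall>n. \<beta> n \<in> digits"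
    if "\<exists>\<alpha>. (\<forall>n. \<alpha> n \<in> digits) \<and> (\<forall>n. \<beta> n = \<theta> (\<alpha> n))"
    using that by (auto simp: \<theta>_in_digits_iff)
  ultimately show ?thesis
    unfolding is_3'_representation_def by blast
qed

lemma Delta3'_sums:
  assumes "\<And>n. \<beta> n \<in> digits"
  shows "(\<lambda>n. real (\<beta> n) / 3 ^ Suc n) sums Delta3' \<beta>"
  unfolding Delta3'_def by (rule summable_sums[OF summable_digits[OF assms]])

section \<open>Existence\<close>

text \<open>
  Capping the digit at \<open>2\<close> matters only for the remainder \<open>1\<close>: it stays \<open>1\<close> forever and
  produces the expansion \<open>2, 2, \<dots>\<close>, so that \<open>x = 1\<close> is not a special case.
\<close>

definition greedy_digit :: "real \<Rightarrow> nat" where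
  "greedy_digit r = min 2 (nat \<lfloor>3 * r\<rfloor>)"

primrec remainder :: "real \<Rightarrow> nat \<Rightarrow> real" where
  "remainder x 0 = x"
| "remainder x (Suc n) = 3 * remainder x n - real (greedy_digit (remainder x n))"

lemma remainder_in_unit_interval:
  assumes "x \<in> {0..1}"
  shows "remainder x n \<in> {0..1}"
proof (induction n)
  case 0
  then show ?case using assms by simp
next
  case (Suc n)
  define r where "r = remainder x n"
  have r: "0 \<le> r" "r \<le> 1" using Suc by (auto simp: r_def)
  have "real (greedy_digit r) = min 2 (of_int \<lfloor>3 * r\<rfloor>)"
    using r(1) by (simp add: greedy_digit_def of_nat_min)
  then have "3 * r - real (greedy_digit r) \<in> {0..1}"
    using r by (auto simp: min_def) linarith+
  then show ?case by (simp add: r_def)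
qed

lemma ternary_expansion_exists:
  assumes "x \<in> {0..1}"
  obtains \<beta> where "\<And>n. \<beta> n \<in> digits" "x = Delta3' \<beta>"
proof -
  define \<beta> where "\<beta> n = greedy_digit (remainder x n)" for n
  have digits: "\<beta> n \<in> digits" for n
    by (simp add: digits_iff \<beta>_def greedy_digit_def)
  have partial: "(\<Sum>i<n. real (\<beta> i) / 3 ^ Suc i) = x - remainder x n / 3 ^ n" for n
    by (induction n) (auto simp: \<beta>_def field_simps)
  have "(\<lambda>n. remainder x n / 3 ^ n) \<longlonglongrightarrow> 0"
  proof (rule tendsto_sandwich[of "\<lambda>_. 0" _ _ "\<lambda>n. (1 / 3) ^ n"])
    show "(\<lambda>n. (1 / 3 :: real) ^ n) \<longlonglongrightarrow> 0"
      by (rule LIMSEQ_power_zero) simp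
    show "\<forall>\<^sub>F n in sequentially. 0 \<le> remainder x n / 3 ^ n"
      using remainder_in_unit_interval[OF assms] by simp
    show "\<forall>\<^sub>F n in sequentially. remainder x n / 3 ^ n \<le> (1 / 3) ^ n"
      using remainder_in_unit_interval[OF assms]
      by (simp add: power_one_over divide_right_mono)
  qed simp
  then have "(\<lambda>n. x - remainder x n / 3 ^ n) \<longlonglongrightarrow> x - 0"
    by (intro tendsto_diff tendsto_const)
  then have "(\<lambda>n. real (\<beta> n) / 3 ^ Suc n) sums x"
    by (simp only: sums_def partial) simp
  then have "x = Delta3' \<beta>"
    using Delta3'_sums[OF digits] by (rule sums_unique2)
  with digits show ?thesis by (rule that)
qed

section \<open>Extremal values\<close>

lemma Delta3'_nonneg:
  assumes "\<And>n. \<beta> n \<in> digits"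
  shows "0 \<le> Delta3' \<beta>"
  unfolding Delta3'_def by (rule suminf_nonneg[OF summable_digits[OF assms]]) simp

lemma Delta3'_eq_0_imp:
  assumes "\<And>n. \<beta> n \<in> digits" and "Delta3' \<beta> = 0"
  shows "\<beta> n = 0"
  using suminf_eq_zero_iff[OF summable_digits[OF assms(1)]] assms(2)
  by (simp add: Delta3'_def)

text \<open>
  Replacing each digit by its complement carries every fact about the value \<open>0\<close> over to the
  value \<open>1\<close>, because \<open>2, 2, \<dots>\<close> has the value \<open>1\<close>.
\<close>

lemma Delta3'_complement:
  assumes "\<And>n. \<beta> n \<in> digits"
  shows "Delta3' (\<lambda>n. 2 - \<beta> n) = 1 - Delta3' \<beta>"
proof -
  have "(\<lambda>n. 2 / 3 * (1 / 3 :: real) ^ n) sums (2 / 3 * (1 / (1 - 1 / 3)))"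
    by (intro sums_mult geometric_sums) auto
  then have "(\<lambda>n. 2 / 3 ^ Suc n :: real) sums 1"
    by (simp add: power_one_over)
  from sums_diff[OF this Delta3'_sums[OF assms]]
  have "(\<lambda>n. real (2 - \<beta> n) / 3 ^ Suc n) sums (1 - Delta3' \<beta>)"
    using assms by (simp add: digits_iff of_nat_diff diff_divide_distrib)
  then show ?thesis
    unfolding Delta3'_def[of "\<lambda>n. 2 - \<beta> n"] by (rule sums_unique[symmetric])
qed

lemma Delta3'_le_1:
  assumes "\<And>n. \<beta> n \<in> digits"
  shows "Delta3' \<beta> \<le> 1"
  using Delta3'_nonneg[of "\<lambda>n. 2 - \<beta> n"] Delta3'_complement[OF assms]
  by (simp add: digits_iff)

lemma Delta3'_eq_1_imp:
  assumes "\<And>n. \<beta> n \<in> digits" and "Delta3' \<beta> = 1"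
  shows "\<beta> n = 2"
proof -
  have "2 - \<beta> n = 0"
    using Delta3'_complement[OF assms(1)] assms(2)
    by (intro Delta3'_eq_0_imp[of "\<lambda>n. 2 - \<beta> n"]) (auto simp: digits_iff)
  then show ?thesis using assms(1)[of n] by (simp add: digits_iff)
qed

section \<open>Coincidence of two expansions\<close>

lemma Delta3'_Suc:
  assumes "\<And>n. \<beta> n \<in> digits"
  shows "3 * Delta3' \<beta> = real (\<beta> 0) + Delta3' (\<lambda>n. \<beta> (Suc n))"
proof -
  let ?f = "\<lambda>n. real (\<beta> n) / 3 ^ n"
  have "(\<lambda>n. 3 * (real (\<beta> n) / 3 ^ Suc n)) sums (3 * Delta3' \<beta>)"
    by (rule sums_mult[OF Delta3'_sums[OF assms]])
  then have "?f sums (3 * Delta3' \<beta>)" by simp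
  then have "(\<lambda>n. ?f (Suc n)) sums (3 * Delta3' \<beta> - ?f 0)"
    by (subst sums_Suc_iff) simp
  moreover have "(\<lambda>n. ?f (Suc n)) sums Delta3' (\<lambda>n. \<beta> (Suc n))"
    using Delta3'_sums[of "\<lambda>n. \<beta> (Suc n)"] assms by simp
  ultimately have "3 * Delta3' \<beta> - ?f 0 = Delta3' (\<lambda>n. \<beta> (Suc n))"
    by (rule sums_unique2)
  then show ?thesis by simp
qed

lemma Delta3'_drop_common_prefix:
  assumes "\<And>n. \<beta> n \<in> digits" and "\<And>n. \<gamma> n \<in> digits"
    and "Delta3' \<beta> = Delta3' \<gamma>" and "\<And>i. i < m \<Longrightarrow> \<beta> i = \<gamma> i"
  shows "Delta3' (\<lambda>n. \<beta> (n + m)) = Delta3' (\<lambda>n. \<gamma> (n + m))"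
  using assms(4)
proof (induction m)
  case 0
  then show ?case using assms(3) by simp
next
  case (Suc m)
  then have "Delta3' (\<lambda>n. \<beta> (n + m)) = Delta3' (\<lambda>n. \<gamma> (n + m))" and "\<beta> m = \<gamma> m"
    by auto
  then show ?case
    using Delta3'_Suc[of "\<lambda>n. \<beta> (n + m)"] Delta3'_Suc[of "\<lambda>n. \<gamma> (n + m)"] assms(1,2)
    by simp
qed

text \<open>
  The digit in position \<open>m\<close> differs by at least \<open>1\<close>, which is as much as the tails can make
  up for; so both tails are extremal. Both sequences are expressed through the
  larger one because \<open>ending_2\<close> lowers the last digit of its argument.
\<close>

lemma first_difference:
  assumes \<beta>: "\<And>n. \<beta> n \<in> digits" and \<gamma>: "\<And>n. \<gamma> n \<in> digits"
    and eq: "Delta3' \<beta> = Delta3' \<gamma>"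
    and prefix: "\<And>i. i < m \<Longrightarrow> \<beta> i = \<gamma> i" and less: "\<beta> m < \<gamma> m"
  shows "\<beta> = ending_2 m \<gamma>" and "\<gamma> = ending_0 m \<gamma>"
proof -
  define s where "s = Delta3' (\<lambda>n. \<beta> (n + Suc m))"
  define t where "t = Delta3' (\<lambda>n. \<gamma> (n + Suc m))"
  have "Delta3' (\<lambda>n. \<beta> (n + m)) = Delta3' (\<lambda>n. \<gamma> (n + m))"
    using Delta3'_drop_common_prefix[OF \<beta> \<gamma> eq prefix] .
  then have "real (\<beta> m) + s = real (\<gamma> m) + t"
    using Delta3'_Suc[of "\<lambda>n. \<beta> (n + m)"] Delta3'_Suc[of "\<lambda>n. \<gamma> (n + m)"] \<beta> \<gamma>
    by (simp add: s_def t_def)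
  moreover have "s \<le> 1" unfolding s_def by (rule Delta3'_le_1[OF \<beta>])
  moreover have "0 \<le> t" unfolding t_def by (rule Delta3'_nonneg[OF \<gamma>])
  moreover have "real (\<beta> m) + 1 \<le> real (\<gamma> m)" using less by linarith
  ultimately have digit: "real (\<gamma> m) = real (\<beta> m) + 1" and s: "s = 1" and t: "t = 0"
    by linarith+
  have tail_2: "\<beta> i = 2" if "m < i" for i
    using Delta3'_eq_1_imp[OF \<beta> s[unfolded s_def], of "i - Suc m"] that by simp
  have tail_0: "\<gamma> i = 0" if "m < i" for i
    using Delta3'_eq_0_imp[OF \<gamma> t[unfolded t_def], of "i - Suc m"] that by simp
  have "\<beta> m = \<gamma> m - 1" using digit by linarith
  then show "\<beta> = ending_2 m \<gamma>"
    using prefix tail_2 by (auto simp: ending_2_def fun_eq_iff)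
  show "\<gamma> = ending_0 m \<gamma>"
    using tail_0 by (auto simp: ending_0_def fun_eq_iff)
qed

lemma first_difference_exists:
  fixes \<beta> \<gamma> :: "nat \<Rightarrow> nat"
  assumes "\<beta> \<noteq> \<gamma>"
  obtains m where "\<And>i. i < m \<Longrightarrow> \<beta> i = \<gamma> i" and "\<beta> m < \<gamma> m \<or> \<gamma> m < \<beta> m"
proof -
  have "\<exists>m. \<beta> m \<noteq> \<gamma> m" using assms by auto
  then obtain m where "\<beta> m \<noteq> \<gamma> m" "\<forall>i<m. \<beta> i = \<gamma> i"
    using exists_least_iff[of "\<lambda>m. \<beta> m \<noteq> \<gamma> m"] by auto
  then show ?thesis using that by (meson linorder_neqE_nat)
qed

lemma two_expansions_imp_rational:
  assumes "is_3'_representation \<beta> x" and "is_3'_representation \<gamma> x" and "\<beta> \<noteq> \<gamma>"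
  shows "is_3'_rational x"
proof -
  have rational: "is_3'_rational x"
    if \<beta>: "is_3'_representation \<beta> x" and \<gamma>: "is_3'_representation \<gamma> x"
      and prefix: "\<And>i. i < m \<Longrightarrow> \<beta> i = \<gamma> i" and less: "\<beta> m < \<gamma> m" for \<beta> \<gamma> m
  proof -
    have "\<gamma> = ending_0 m \<gamma>"
      by (rule first_difference(2)[of \<beta> \<gamma> m])
        (use \<beta> \<gamma> prefix less in \<open>auto simp: is_3'_representation_iff\<close>)
    moreover have "x \<in> {0..1}"
      using \<gamma> Delta3'_nonneg[of \<gamma>] Delta3'_le_1[of \<gamma>] by (simp add: is_3'_representation_iff)
    ultimately show ?thesis
      using \<gamma> less unfolding is_3'_rational_def is_3'_representation_iff
      by (metis not_less_zero)
  qed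
  obtain m where prefix: "\<And>i. i < m \<Longrightarrow> \<beta> i = \<gamma> i" and "\<beta> m < \<gamma> m \<or> \<gamma> m < \<beta> m"
    using first_difference_exists[OF assms(3)] by blast
  from this(2) show ?thesis
    using rational[OF assms(1,2) prefix] rational[OF assms(2,1) prefix[symmetric]] by blast
qed

lemma representations_of_rational:
  assumes c: "\<And>j. j \<le> m \<Longrightarrow> c j \<in> digits" and cm: "c m \<noteq> 0"
  shows "{\<beta>. is_3'_representation \<beta> (Delta3' (ending_0 m c))} = {ending_0 m c, ending_2 m c}"
proof -
  define e where "e = ending_0 m c"
  have e_digits: "e n \<in> digits" for n
    using c[of n] by (auto simp: e_def ending_0_def digits_def)
  have "ending_2 m c n \<in> digits" for n
    using c[of n] c[of m] by (auto simp: ending_2_def digits_def)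
  then have "is_3'_representation (ending_2 m c) (Delta3' e)"
    using Delta3'_ending_0_eq_ending_2[of m c] c cm by (simp add: is_3'_representation_iff e_def)
  moreover have "is_3'_representation e (Delta3' e)"
    using e_digits by (simp add: is_3'_representation_iff)
  moreover have "\<gamma> = ending_2 m c" if "is_3'_representation \<gamma> (Delta3' e)" "\<gamma> \<noteq> e" for \<gamma>
  proof -
    have \<gamma>_digits: "\<And>n. \<gamma> n \<in> digits" and eq: "Delta3' \<gamma> = Delta3' e"
      using that(1) by (auto simp: is_3'_representation_iff)
    obtain k where prefix: "\<And>i. i < k \<Longrightarrow> \<gamma> i = e i" and "\<gamma> k < e k \<or> e k < \<gamma> k"
      using first_difference_exists[OF \<open>\<gamma> \<noteq> e\<close>] by blast
    from this(2) show ?thesis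
    proof
      assume less: "\<gamma> k < e k"
      note forms = first_difference[OF \<gamma>_digits e_digits eq prefix less]
      \<comment> \<open>Both \<open>k\<close> and \<open>m\<close> are the position of the last nonzero digit of \<open>e\<close>.\<close>
      have "k \<le> m" using less by (auto simp: e_def ending_0_def split: if_splits)
      moreover have "m \<le> k"
        using fun_cong[OF forms(2), of m] cm by (auto simp: e_def ending_0_def split: if_splits)
      ultimately have "k = m" by simp
      then show ?thesis
        using forms(1) by (auto simp: e_def ending_0_def ending_2_def fun_eq_iff)
    next
      assume less: "e k < \<gamma> k"
      have "e = ending_2 k \<gamma>"
        using first_difference(1)[OF e_digits \<gamma>_digits eq[symmetric] prefix[symmetric] less] .
      \<comment> \<open>Beyond both \<open>k\<close> and \<open>m\<close>, this sequence would have the digit \<open>0\<close> as well as \<open>2\<close>.\<close>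
      from fun_cong[OF this, of "Suc (k + m)"] have False
        by (simp add: e_def ending_0_def ending_2_def)
      then show ?thesis ..
    qed
  qed
  ultimately show ?thesis unfolding e_def by blast
qed

theorem lemma1:
  "(\<forall>x\<in>{0..1::real}. \<exists>\<alpha> \<beta>. (\<forall>n. \<alpha> n \<in> digits) \<and> (\<forall>n. \<beta> n = \<theta> (\<alpha> n)) \<and>
       x = Delta3' \<beta> \<and> (\<lambda>n. real (\<theta> (\<alpha> n)) / 3 ^ Suc n) sums x) \<and>
   (\<forall>x. is_3'_irrational x \<longrightarrow> (\<exists>!\<beta>. is_3'_representation \<beta> x)) \<and>
   (\<forall>x. is_3'_rational x \<longrightarrow> card {\<beta>. is_3'_representation \<beta> x} = 2)"
proof (intro conjI ballI allI impI)
  fix x :: real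
  assume "x \<in> {0..1}"
  then obtain \<beta> where \<beta>: "\<And>n. \<beta> n \<in> digits" "x = Delta3' \<beta>"
    using ternary_expansion_exists by blast
  show "\<exists>\<alpha> \<beta>. (\<forall>n. \<alpha> n \<in> digits) \<and> (\<forall>n. \<beta> n = \<theta> (\<alpha> n)) \<and>
       x = Delta3' \<beta> \<and> (\<lambda>n. real (\<theta> (\<alpha> n)) / 3 ^ Suc n) sums x"
    by (rule exI[of _ "\<lambda>n. \<theta> (\<beta> n)"], rule exI[of _ \<beta>])
      (use \<beta> Delta3'_sums[OF \<beta>(1)] in \<open>simp add: \<theta>_in_digits_iff \<theta>_involution\<close>)
next
  fix x
  assume x: "is_3'_irrational x"
  then obtain \<beta> where "\<And>n. \<beta> n \<in> digits" "x = Delta3' \<beta>"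
    using ternary_expansion_exists unfolding is_3'_irrational_def by blast
  then have "is_3'_representation \<beta> x" by (simp add: is_3'_representation_iff)
  then show "\<exists>!\<beta>. is_3'_representation \<beta> x"
    using x two_expansions_imp_rational unfolding is_3'_irrational_def by blast
next
  fix x
  assume "is_3'_rational x"
  then obtain m c where c: "\<And>j. j \<le> m \<Longrightarrow> c j \<in> digits" "c m \<noteq> 0"
    and x: "x = Delta3' (ending_0 m c)"
    unfolding is_3'_rational_def by blast
  have "ending_0 m c m \<noteq> ending_2 m c m"
    using c(2) by (simp add: ending_0_def ending_2_def)
  then have "ending_0 m c \<noteq> ending_2 m c" by metis
  then show "card {\<beta>. is_3'_representation \<beta> x} = 2"
    unfolding x using representations_of_rational[of m c] c by simp
qed

end
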